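(* Let $\mathbb{K}$ be a field and $\mathbb{L}=\mathbb{K}[\mathbb{V}]$. Let $E$ be a finite subset of $\mathbb{L}$, define $d:E\times_{\neq}E\to\mathbb{V}$ by $d(a,b)=-\mathrm{ord}(a-b)$, and let $w:E\to\mathbb{V}$ be any function (then $(E,w,d)$ is a $\mathbb{V}$-ultra triple). Then the Bhargava greedoid of the $\mathbb{V}$-ultra triple $(E,w,d)$ is the Gaussian elimination greedoid of a vector family over $\mathbb{K}$.
   Context: $\mathbb{V}$ is a totally ordered abelian group (translation-invariant total order). $\mathbb{K}[\mathbb{V}]$ is the group algebra: a $\mathbb{K}$-vector space with basis $(t_\alpha)_{\alpha\in\mathbb{V}}$ and multiplication $t_\alpha t_\beta=t_{\alpha+\beta}$, unity $t_0$. For $a\in\mathbb{L}$ and $\beta\in\mathbb{V}$, $[t_\beta]a\in\mathbb{K}$ is the coefficient of $t_\beta$ in $a$. For nonzero $a$, $\mathrm{ord}\,a$ is the smallest $\beta\in\mathbb{V}$ with $[t_\beta]a\neq0$. $E\times_{\neq}E=\{(a,b)\in E\times E: a\neq b\}$. A $\mathbb{V}$-ultra triple is $(E,w,d)$ with $w:E\to\mathbb{V}$, $d:E\times_{\neq}E\to\mathbb{V}$, $d$ symmetric and $d(a,b)\le\max\{d(a,c),d(b,c)\}$ for distinct $a,b,c$. $\mathrm{PER}(A)=\sum_{a\in A}w(a)+\sum_{\{a,b\}\subseteq A,\,a\ne b}d(a,b)$ (unordered pairs). For finite $E$, the Bhargava greedoid is $\{A\subseteq E:\ \mathrm{PER}(A)\ge\mathrm{PER}(B)\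 \forall B\subseteq E,\ |B|=|A|\}$. The Gaussian elimination greedoid of a vector family $(v_e)_{e\in E}$ with $v_e\in\mathbb{K}^m$, $m\ge|E|$, is $\{F\subseteq E: (\pi_{|F|}(v_e))_{e\in F}\text{ linearly independent}\}$, where $\pi_k:\mathbb{K}^m\to\mathbb{K}^k$ keeps the first $k$ coordinates. *)

theory Defs
  imports
    "HOL-Library.Poly_Mapping"
    "Jordan_Normal_Form.VS_Connect"
begin

text \<open>The group algebra of a totally ordered abelian group \<open>'v\<close> over a field \<open>'k\<close> is the type
  \<open>'v \<Rightarrow>\<^sub>0 'k\<close> of finitely supported functions, whose library multiplication is convolution.
  The coefficient of \<open>t\<^sub>\<beta>\<close> in \<open>a\<close> is \<open>Poly_Mapping.lookup a \<beta>\<close>.\<close>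

text \<open>Meaningful only for \<open>a \<noteq> 0\<close>; the least element then exists since the support is finite.\<close>

definition ga_ord :: "('v::linordered_ab_group_add \<Rightarrow>\<^sub>0 'k::field) \<Rightarrow> 'v" where
  "ga_ord a = (LEAST \<beta>. Poly_Mapping.lookup a \<beta> \<noteq> 0)"

text \<open>The distance is a total function on pairs; its values on the diagonal are never used.
  The weight is unconstrained.\<close>

definition ultra_triple ::
  "'e set \<Rightarrow> ('e \<Rightarrow> 'v::linordered_ab_group_add) \<Rightarrow> ('e \<Rightarrow> 'e \<Rightarrow> 'v) \<Rightarrow> bool" where
  "ultra_triple E w d \<longleftrightarrow>
     (\<forall>a\<in>E. \<forall>b\<in>E. a \<noteq> b \<longrightarrow> d a b = d b a) \<and>
     (\<forall>a\<in>E. \<forall>b\<in>E. \<forall>c\<in>E. a \<noteq> b \<longrightarrow> a \<noteq> c \<longrightarrow> b \<noteq> c \<longrightarrow> d a b \<le> max (d a c) (d b c))"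

text \<open>The value of a symmetric \<open>d\<close> on an unordered pair \<open>p = {a, b}\<close> with \<open>a \<noteq> b\<close>.\<close>

definition pair_dist :: "('e \<Rightarrow> 'e \<Rightarrow> 'v) \<Rightarrow> 'e set \<Rightarrow> 'v" where
  "pair_dist d p = (THE x. \<exists>a b. a \<noteq> b \<and> p = {a, b} \<and> x = d a b)"

lemma pair_dist_doubleton:
  assumes "a \<noteq> b" and "d a b = d b a"
  shows "pair_dist d {a, b} = d a b"
  unfolding pair_dist_def
proof (rule the_equality)
  show "\<exists>a' b'. a' \<noteq> b' \<and> {a, b} = {a', b'} \<and> d a b = d a' b'"
    using assms(1) by blast
qed (use assms(2) in \<open>auto simp: doubleton_eq_iff\<close>)

definition perimeter ::
  "('e \<Rightarrow> 'v::linordered_ab_group_add) \<Rightarrow> ('e \<Rightarrow> 'e \<Rightarrow> 'v) \<Rightarrow> 'e set \<Rightarrow> 'v" where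
  "perimeter w d A = (\<Sum>a\<in>A. w a) + (\<Sum>p | p \<subseteq> A \<and> card p = 2. pair_dist d p)"

definition bhargava_greedoid ::
  "'e set \<Rightarrow> ('e \<Rightarrow> 'v::linordered_ab_group_add) \<Rightarrow> ('e \<Rightarrow> 'e \<Rightarrow> 'v) \<Rightarrow> 'e set set" where
  "bhargava_greedoid E w d =
     {A. A \<subseteq> E \<and> (\<forall>B. B \<subseteq> E \<and> card B = card A \<longrightarrow> perimeter w d A \<ge> perimeter w d B)}"

text \<open>Linear independence of a finite family, not just of the set of its members: repeated
  vectors make a family dependent.\<close>

definition lin_indpt_family :: "nat \<Rightarrow> 'e set \<Rightarrow> ('e \<Rightarrow> 'k::field vec) \<Rightarrow> bool" where
  "lin_indpt_family k F u \<longleftrightarrow>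
     inj_on u F \<and> u ` F \<subseteq> carrier_vec k \<and>
     \<not> module.lin_dep class_ring (module_vec TYPE('k) k) (u ` F)"

text \<open>For \<open>x\<close> of dimension at least \<open>k\<close>, \<open>vec_first x k\<close> consists of the first \<open>k\<close> coordinates of \<open>x\<close>.\<close>

definition gaussian_elimination_greedoid :: "'e set \<Rightarrow> ('e \<Rightarrow> 'k::field vec) \<Rightarrow> 'e set set" where
  "gaussian_elimination_greedoid E v =
     {F. F \<subseteq> E \<and> lin_indpt_family (card F) F (\<lambda>e. vec_first (v e) (card F))}"

end

(* Choose a greedy sequence c_0, c_1, ... in E, so that c_j maximises w a + sum_(i<j) d(c_i, a)
   over the unused a in E, and let rho_j be that maximum. The elements
   t^(rho_j - w a) prod_(i<j) (a - c_i) of the group algebra then have order at least 0, or vanish.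
   Their coefficients at t_0 are the entries of the vector of a. For a k-element A, the k x k matrix
   of these elements has determinant t^(sum rho_j - sum w a) times the Vandermonde determinant of A,
   hence order PER {c_0, ..., c_(k-1)} - PER A. Taking the coefficient at t_0 is a ring homomorphism
   on the elements of nonnegative order. Therefore this difference is nonnegative, and the matrix
   over K is invertible exactly when it is 0, that is, when A has maximal perimeter. *)

theory Submission
  imports Defs "Jordan_Normal_Form.DL_Rank"
begin

section \<open>Orders and leading coefficients in the group algebra\<close>

text \<open>The value \<open>c = 0\<close> is allowed: only \<open>ord a \<ge> \<gamma>\<close> is enforced.\<close>

definition has_lead :: "'v::linordered_ab_group_add \<Rightarrow> 'k::field \<Rightarrow> ('v \<Rightarrow>\<^sub>0 'k) \<Rightarrow> bool" where
  "has_lead \<gamma> c a \<longleftrightarrow> (\<forall>\<beta><\<gamma>. Poly_Mapping.lookup a \<beta> = 0) \<and> Poly_Mapping.lookup a \<gamma> = c"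

lemma has_lead_lookup_below: "has_lead \<gamma> c a \<Longrightarrow> \<beta> < \<gamma> \<Longrightarrow> Poly_Mapping.lookup a \<beta> = 0"
  by (simp add: has_lead_def)

lemma has_lead_lookup: "has_lead \<gamma> c a \<Longrightarrow> Poly_Mapping.lookup a \<gamma> = c"
  by (simp add: has_lead_def)

lemma has_lead_single: "has_lead \<gamma> c (Poly_Mapping.single \<gamma> c)"
  by (auto simp: has_lead_def lookup_single when_def)

lemma has_lead_zero: "has_lead \<gamma> 0 0"
  by (simp add: has_lead_def)

lemma has_lead_one: "has_lead 0 1 1"
  by (auto simp: has_lead_def lookup_one when_def)

lemma has_lead_uminus: "has_lead \<gamma> c a \<Longrightarrow> has_lead \<gamma> (- c) (- a)"
  by (simp add: has_lead_def)

lemma has_lead_sum: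
  "(\<And>i. i \<in> I \<Longrightarrow> has_lead \<gamma> (c i) (a i)) \<Longrightarrow> has_lead \<gamma> (\<Sum>i\<in>I. c i) (\<Sum>i\<in>I. a i)"
  by (simp add: has_lead_def lookup_sum)

text \<open>Subtraction in the group leaves exactly one partner exponent \<open>\<kappa> - l\<close>
  for each \<open>l\<close>, so the double sum of the convolution becomes a single one.\<close>

lemma lookup_mult_group:
  fixes a b :: "'v::linordered_ab_group_add \<Rightarrow>\<^sub>0 'k::field"
  shows "Poly_Mapping.lookup (a * b) \<kappa> =
    (\<Sum>l. Poly_Mapping.lookup a l * Poly_Mapping.lookup b (\<kappa> - l))"
proof -
  have "(\<Sum>q. Poly_Mapping.lookup b q when \<kappa> = l + q) = Poly_Mapping.lookup b (\<kappa> - l)" for l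
  proof -
    have "\<kappa> = l + q \<longleftrightarrow> q = \<kappa> - l" for q
      by (auto simp: algebra_simps)
    then show ?thesis
      by simp
  qed
  then show ?thesis
    by (simp add: lookup_mult)
qed

text \<open>At or below \<open>\<gamma> + \<delta>\<close>, every summand of the convolution except
  the one pairing \<open>\<gamma>\<close> with \<open>\<delta>\<close> has a factor below its
  lead.\<close>

lemma has_lead_mult:
  fixes a b :: "'v::linordered_ab_group_add \<Rightarrow>\<^sub>0 'k::field"
  assumes a: "has_lead \<gamma> c a" and b: "has_lead \<delta> e b"
  shows "has_lead (\<gamma> + \<delta>) (c * e) (a * b)"
proof -
  have zero: "Poly_Mapping.lookup a l * Poly_Mapping.lookup b (\<kappa> - l) = 0"
    if "\<kappa> \<le> \<gamma> + \<delta>" "\<kappa> < \<gamma> + \<delta> \<or> l \<noteq> \<gamma>" for \<kappa> l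
  proof (cases "l < \<gamma>")
    case True
    then show ?thesis
      using has_lead_lookup_below[OF a] by simp
  next
    case False
    \<comment> \<open>Here \<open>l \<ge> \<gamma>\<close>; strictness comes from
      \<open>\<kappa>\<close> or, if \<open>\<kappa>\<close> attains the bound, from
      \<open>l > \<gamma>\<close>.\<close>
    then have "\<kappa> < l + \<delta>"
      using that by (metis add_le_less_mono add_less_le_mono add_strict_right_mono
          linorder_neqE not_less order.strict_trans1 order.strict_trans2 add_right_mono)
    then have "\<kappa> - l < \<delta>"
      by (simp add: algebra_simps)
    then show ?thesis
      using has_lead_lookup_below[OF b] by simp
  qed
  have "Poly_Mapping.lookup (a * b) \<kappa> = 0" if "\<kappa> < \<gamma> + \<delta>" for \<kappa>
    using that by (simp add: lookup_mult_group zero)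
  moreover have "Poly_Mapping.lookup (a * b) (\<gamma> + \<delta>) = c * e"
  proof -
    have "Poly_Mapping.lookup a l * Poly_Mapping.lookup b (\<gamma> + \<delta> - l) = (c * e when l = \<gamma>)" for l
      using zero[of "\<gamma> + \<delta>" l] has_lead_lookup[OF a] has_lead_lookup[OF b]
      by (auto simp: when_def)
    then show ?thesis
      by (simp add: lookup_mult_group)
  qed
  ultimately show ?thesis
    by (simp add: has_lead_def)
qed

lemma has_lead_prod:
  fixes a :: "'i \<Rightarrow> ('v::linordered_ab_group_add \<Rightarrow>\<^sub>0 'k::field)"
  assumes "\<And>i. i \<in> I \<Longrightarrow> has_lead (\<gamma> i) (c i) (a i)"
  shows "has_lead (\<Sum>i\<in>I. \<gamma> i) (\<Prod>i\<in>I. c i) (\<Prod>i\<in>I. a i)"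
  using assms
  by (induction I rule: infinite_finite_induct) (auto intro: has_lead_mult has_lead_one)

lemma has_lead_signof: "has_lead 0 (signof p) (signof p)"
  by (cases p rule: sign_cases) (auto intro: has_lead_one has_lead_uminus)

text \<open>Every term of the Leibniz formula is a sign times a product of entries with lead at
  exponent 0, and leads at a common exponent add up.\<close>

lemma has_lead_det:
  fixes A :: "('v::linordered_ab_group_add \<Rightarrow>\<^sub>0 'k::field) mat"
  assumes A: "A \<in> carrier_mat n n" and B: "B \<in> carrier_mat n n"
    and lead: "\<And>i j. i < n \<Longrightarrow> j < n \<Longrightarrow> has_lead 0 (B $$ (i, j)) (A $$ (i, j))"
  shows "has_lead 0 (det B) (det A)"
proof -
  have "has_lead 0 (signof p * (\<Prod>i = 0..<n. B $$ (i, p i))) (signof p * (\<Prod>i = 0..<n. A $$ (i, p i)))"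
    if "p permutes {0..<n}" for p
  proof -
    have "has_lead (\<Sum>i = 0..<n. 0) (\<Prod>i = 0..<n. B $$ (i, p i)) (\<Prod>i = 0..<n. A $$ (i, p i))"
      using permutes_in_image[OF that] by (intro has_lead_prod lead) auto
    then show ?thesis
      using has_lead_mult[OF has_lead_signof[of p]] by fastforce
  qed
  then show ?thesis
    unfolding det_def'[OF A] det_def'[OF B] by (intro has_lead_sum) auto
qed

text \<open>Since \<open>e \<noteq> 0\<close>, \<open>\<gamma>\<close> is the exact order of
  \<open>a\<close>, while \<open>\<beta>\<close> is only a lower bound at which the coefficient may
  vanish.\<close>

lemma has_lead_compare:
  assumes "has_lead \<beta> c a" and "has_lead \<gamma> e a" and "e \<noteq> 0"
  shows "\<beta> \<le> \<gamma>" and "c \<noteq> 0 \<longleftrightarrow> \<gamma> = \<beta>"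
  using assms unfolding has_lead_def by (metis linorder_less_linear not_le)+

lemma has_lead_lower:
  assumes "has_lead \<gamma> c a" and "\<beta> \<le> \<gamma>"
  shows "has_lead \<beta> (Poly_Mapping.lookup a \<beta>) a"
  using assms by (auto simp: has_lead_def)

text \<open>The group need not be well-ordered; the least exponent is found as the minimum of the
  finite nonempty set of keys.\<close>

lemma
  fixes a :: "'v::linordered_ab_group_add \<Rightarrow>\<^sub>0 'k::field"
  assumes "a \<noteq> 0"
  shows has_lead_ga_ord: "has_lead (ga_ord a) (Poly_Mapping.lookup a (ga_ord a)) a"
    and lookup_ga_ord: "Poly_Mapping.lookup a (ga_ord a) \<noteq> 0"
proof -
  let ?m = "Min (Poly_Mapping.keys a)"
  have m: "?m \<in> Poly_Mapping.keys a"
    using assms by (intro Min_in) auto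
  have least: "?m \<le> \<beta>" if "Poly_Mapping.lookup a \<beta> \<noteq> 0" for \<beta>
    using that by (intro Min_le) (auto simp: in_keys_iff)
  have "ga_ord a = ?m"
    unfolding ga_ord_def using m least by (intro Least_equality) (auto simp: in_keys_iff)
  then show "has_lead (ga_ord a) (Poly_Mapping.lookup a (ga_ord a)) a"
    and "Poly_Mapping.lookup a (ga_ord a) \<noteq> 0"
    using least m by (auto simp: has_lead_def in_keys_iff not_less[symmetric])
qed

section \<open>The ultrametric inequality for the order\<close>

lemma ga_ord_uminus: "ga_ord (- a) = ga_ord a"
  by (simp add: ga_ord_def)

text \<open>At an exponent below both orders, both coefficients vanish, and so does their
  difference.\<close>

lemma ga_ord_diff_ge:
  fixes a b :: "'v::linordered_ab_group_add \<Rightarrow>\<^sub>0 'k::field"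
  assumes "a \<noteq> 0" and "b \<noteq> 0" and "a - b \<noteq> 0"
  shows "min (ga_ord a) (ga_ord b) \<le> ga_ord (a - b)"
proof (rule ccontr)
  assume less: "\<not> ?thesis"
  then have "Poly_Mapping.lookup a (ga_ord (a - b)) = 0" "Poly_Mapping.lookup b (ga_ord (a - b)) = 0"
    using has_lead_lookup_below[OF has_lead_ga_ord] assms(1,2) by (auto simp: not_le)
  then show False
    using lookup_ga_ord[OF assms(3)] by (simp add: lookup_minus)
qed

text \<open>Since \<open>a - b = (a - c) - (b - c)\<close>, the order is bounded below by a minimum,
  and negation turns this into the upper bound by a maximum.\<close>

lemma ultra_triple_ga_ord:
  fixes E :: "('v::linordered_ab_group_add \<Rightarrow>\<^sub>0 'k::field) set"
  assumes "\<And>a b. a \<in> E \<Longrightarrow> b \<in> E \<Longrightarrow> a \<noteq> b \<Longrightarrow> d a b = - ga_ord (a - b)"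
  shows "ultra_triple E w d"
  unfolding ultra_triple_def
proof (intro conjI ballI impI)
  fix a b assume ab: "a \<in> E" "b \<in> E" "a \<noteq> b"
  then show "d a b = d b a"
    using assms[OF ab] assms[of b a] ga_ord_uminus[of "a - b"] by simp
next
  fix a b c assume abc: "a \<in> E" "b \<in> E" "c \<in> E" "a \<noteq> b" "a \<noteq> c" "b \<noteq> c"
  then have "min (ga_ord (a - c)) (ga_ord (b - c)) \<le> ga_ord (a - b)"
    using ga_ord_diff_ge[of "a - c" "b - c"] by simp
  then show "d a b \<le> max (d a c) (d b c)"
    using abc by (simp add: assms) (auto simp: min_def max_def split: if_splits)
qed

section \<open>Newton-type determinants\<close>

text \<open>Expanding the \<open>p j\<close> in powers factors the matrix into the coefficient
  matrix, triangular with ones on its diagonal, times the Vandermonde matrix.\<close>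

lemma det_mat_poly_monic:
  fixes p :: "nat \<Rightarrow> 'a::idom poly"
  assumes deg: "\<And>j. j < n \<Longrightarrow> degree (p j) = j" and lc: "\<And>j. j < n \<Longrightarrow> lead_coeff (p j) = 1"
  shows "det (mat n n (\<lambda>(j, r). poly (p j) (x r))) = det (mat n n (\<lambda>(l, r). x r ^ l))"
proof -
  let ?C = "mat n n (\<lambda>(j, l). coeff (p j) l)"
  let ?V = "mat n n (\<lambda>(l, r). x r ^ l)"
  have "poly (p j) y = (\<Sum>l<n. coeff (p j) l * y ^ l)" if "j < n" for j y
  proof -
    have "poly (p j) y = (\<Sum>l\<le>j. coeff (p j) l * y ^ l)"
      using deg[OF that] by (simp add: poly_altdef)
    also have "\<dots> = (\<Sum>l<n. coeff (p j) l * y ^ l)"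
      using that deg[OF that] by (intro sum.mono_neutral_left) (auto intro: coeff_eq_0)
    finally show ?thesis .
  qed
  then have "mat n n (\<lambda>(j, r). poly (p j) (x r)) = ?C * ?V"
    by (intro eq_matI) (auto simp: scalar_prod_def lessThan_atLeast0)
  moreover have "det ?C = 1"
  proof -
    have "det ?C = prod_list (diag_mat ?C)"
      using deg by (intro det_lower_triangular[where n = n]) (auto intro: coeff_eq_0)
    also have "\<dots> = (\<Prod>j = 0..<n. ?C $$ (j, j))"
      by (simp add: prod_list_diag_prod)
    also have "\<dots> = 1"
      using deg lc by (intro prod.neutral) auto
    finally show ?thesis .
  qed
  ultimately show ?thesis
    by (simp add: det_mult[of _ n])
qed

text \<open>Both the basis attached to \<open>c\<close> and the one attached to \<open>x\<close> itself consist of monic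
  polynomials, and the latter gives a triangular matrix.\<close>

lemma det_newton:
  fixes x c :: "nat \<Rightarrow> 'a::idom"
  shows "det (mat n n (\<lambda>(j, r). \<Prod>i<j. x r - c i)) = (\<Prod>r<n. \<Prod>i<r. x r - x i)"
proof -
  have newton: "det (mat n n (\<lambda>(j, r). \<Prod>i<j. x r - y i)) = det (mat n n (\<lambda>(l, r). x r ^ l))" for y
  proof -
    let ?p = "\<lambda>j. \<Prod>i<j. [:- y i, 1:]"
    have "degree (?p j) = j" for j
      by (subst degree_prod_eq_sum_degree) auto
    moreover have "lead_coeff (?p j) = 1" for j
      by (simp add: lead_coeff_prod)
    ultimately have "det (mat n n (\<lambda>(j, r). poly (?p j) (x r))) = det (mat n n (\<lambda>(l, r). x r ^ l))"
      by (intro det_mat_poly_monic) auto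
    then show ?thesis
      by (simp add: poly_prod)
  qed
  let ?T = "mat n n (\<lambda>(j, r). \<Prod>i<j. x r - x i)"
  \<comment> \<open>Below the diagonal, \<open>j > r\<close>, the product contains the zero factor
    at \<open>i = r\<close>.\<close>
  have "det ?T = prod_list (diag_mat ?T)"
    by (rule det_upper_triangular[where n = n]) (auto intro!: prod_zero simp: upper_triangular_def)
  also have "\<dots> = (\<Prod>r<n. \<Prod>i<r. x r - x i)"
    by (simp add: prod_list_diag_prod lessThan_atLeast0)
  finally show ?thesis
    using newton[of c] newton[of x] by simp
qed

text \<open>In each Leibniz term the permutation only reorders the product of the column factors
  \<open>g\<close>. This serves to strip monomials off a Newton matrix.\<close>

lemma det_mat_scale:
  fixes f g :: "nat \<Rightarrow> 'a::comm_ring_1"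
  shows "det (mat n n (\<lambda>(i, j). f i * g j * M i j)) =
    (\<Prod>i<n. f i) * (\<Prod>j<n. g j) * det (mat n n (\<lambda>(i, j). M i j))"
proof -
  have "(\<Prod>i = 0..<n. mat n n (\<lambda>(i, j). f i * g j * M i j) $$ (i, p i)) =
      (\<Prod>i<n. f i) * (\<Prod>j<n. g j) * (\<Prod>i = 0..<n. mat n n (\<lambda>(i, j). M i j) $$ (i, p i))"
    if "p permutes {0..<n}" for p
  proof -
    have "(\<Prod>i = 0..<n. mat n n (\<lambda>(i, j). f i * g j * M i j) $$ (i, p i)) =
        (\<Prod>i = 0..<n. f i * g (p i) * mat n n (\<lambda>(i, j). M i j) $$ (i, p i))"
      using permutes_in_image[OF that] by (intro prod.cong) auto
    moreover have "(\<Prod>i = 0..<n. g (p i)) = (\<Prod>i = 0..<n. g i)"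
      using prod.permute[OF that, of g] by (simp add: comp_def)
    ultimately show ?thesis
      by (simp add: prod.distrib lessThan_atLeast0)
  qed
  then show ?thesis
    unfolding det_def'[OF mat_carrier] sum_distrib_left
    by (intro sum.cong refl) (simp only: mem_Collect_eq ac_simps)
qed

section \<open>Linear independence of a family as a determinant condition\<close>

lemma lin_indpt_family_det:
  fixes u :: "'e \<Rightarrow> 'k::field vec"
  assumes bij: "bij_betw x {..<k} F" and u: "\<And>e. e \<in> F \<Longrightarrow> u e \<in> carrier_vec k"
  shows "lin_indpt_family k F u \<longleftrightarrow> det (mat k k (\<lambda>(j, r). u (x r) $ j)) \<noteq> 0"
proof -
  interpret vec_space "TYPE('k)" k .
  let ?M = "mat k k (\<lambda>(j, r). u (x r) $ j)"
  have M: "?M \<in> carrier_mat k k"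
    by simp
  have xF: "x r \<in> F" if "r < k" for r
    using bij that by (auto simp: bij_betw_def)
  have cols: "cols ?M = map (\<lambda>r. u (x r)) [0..<k]"
  proof (rule nth_equalityI)
    fix r assume "r < length (cols ?M)"
    then show "cols ?M ! r = map (\<lambda>r. u (x r)) [0..<k] ! r"
      using u[OF xF[of r]] by (auto intro!: eq_vecI)
  qed simp
  have set_cols: "set (cols ?M) = u ` F"
    using bij by (auto simp: cols bij_betw_def)
  have "distinct (cols ?M) \<longleftrightarrow> inj_on (u \<circ> x) {..<k}"
    by (simp add: cols distinct_map lessThan_atLeast0 comp_def)
  also have "\<dots> \<longleftrightarrow> inj_on u F"
    using bij comp_inj_on_iff[of x "{..<k}" u] by (auto simp: bij_betw_def)
  finally have "lin_indpt_family k F u \<longleftrightarrow> distinct (cols ?M) \<and> lin_indpt (set (cols ?M))"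
    using u by (auto simp: lin_indpt_family_def set_cols)
  \<comment> \<open>A repeated column lowers the rank, so full rank captures injectivity together
    with independence.\<close>
  also have "\<dots> \<longleftrightarrow> rank ?M = k"
    using lin_indpt_full_rank[OF M] full_rank_lin_indpt[OF M] non_distinct_low_rank[OF M] by fastforce
  finally show ?thesis
    using det_rank_iff[OF M] by simp
qed

section \<open>Perimeters and greedy sequences\<close>

text \<open>A pair in the larger set either lies in \<open>A\<close> or joins \<open>x\<close> to
  one \<open>y\<close> in \<open>A\<close>; \<open>sym\<close> makes its value independent of the
  orientation.\<close>

lemma perimeter_insert:
  assumes "finite A" and "x \<notin> A" and sym: "\<And>y. y \<in> A \<Longrightarrow> d y x = d x y"
  shows "perimeter w d (insert x A) = perimeter w d A + (w x + (\<Sum>y\<in>A. d y x))"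
proof -
  let ?P = "\<lambda>B. {p. p \<subseteq> B \<and> card p = 2}"
  have P: "?P (insert x A) = ?P A \<union> (\<lambda>y. {y, x}) ` A"
  proof (intro equalityI subsetI)
    fix p assume p: "p \<in> ?P (insert x A)"
    show "p \<in> ?P A \<union> (\<lambda>y. {y, x}) ` A"
    proof (cases "x \<in> p")
      case True
      then obtain y where "p = {y, x}" "y \<noteq> x"
        using p by (auto simp: card_2_iff)
      then show ?thesis
        using p by auto
    qed (use p in auto)
  qed (use assms in \<open>auto simp: card_insert_if\<close>)
  have "sum (pair_dist d) (?P (insert x A)) =
      sum (pair_dist d) (?P A) + sum (pair_dist d) ((\<lambda>y. {y, x}) ` A)"
    unfolding P using assms by (intro sum.union_disjoint) auto
  also have "sum (pair_dist d) ((\<lambda>y. {y, x}) ` A) = (\<Sum>y\<in>A. pair_dist d {y, x})"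
    using assms by (subst sum.reindex) (auto simp: inj_on_def doubleton_eq_iff)
  also have "\<dots> = (\<Sum>y\<in>A. d y x)"
    using assms by (intro sum.cong refl pair_dist_doubleton) auto
  finally show ?thesis
    using assms by (simp add: perimeter_def algebra_simps)
qed

lemma perimeter_empty:
  fixes d :: "'a \<Rightarrow> 'a \<Rightarrow> 'v::linordered_ab_group_add"
  shows "perimeter w d {} = 0"
proof -
  have "{p :: 'a set. p \<subseteq> {} \<and> card p = 2} = {}"
    by auto
  then show ?thesis
    by (simp only: perimeter_def sum.empty add_0)
qed

text \<open>Adding the elements one by one charges each unordered pair to the larger of its two
  indices.\<close>

lemma perimeter_enum:
  fixes x :: "nat \<Rightarrow> 'e"
  assumes "inj_on x {..<k}"
    and sym: "\<And>i j. i < k \<Longrightarrow> j < k \<Longrightarrow> i \<noteq> j \<Longrightarrow> d (x i) (x j) = d (x j) (x i)"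
  shows "perimeter w d (x ` {..<k}) = (\<Sum>r<k. w (x r) + (\<Sum>i<r. d (x i) (x r)))"
  using assms
proof (induction k)
  case 0
  show ?case
    by (simp add: perimeter_empty)
next
  case (Suc k)
  have inj: "inj_on x {..<k}" and notin: "x k \<notin> x ` {..<k}"
    using Suc.prems(1) by (auto simp: lessThan_Suc)
  have "perimeter w d (x ` {..<Suc k}) =
      perimeter w d (x ` {..<k}) + (w (x k) + (\<Sum>y\<in>x ` {..<k}. d y (x k)))"
    unfolding lessThan_Suc image_insert
    using notin Suc.prems(2) by (intro perimeter_insert) force+
  then show ?case
    using Suc.IH[OF inj] Suc.prems(2) by (simp add: sum.reindex[OF inj])
qed

text \<open>By \<open>local\<close>, the objective at stage \<open>j\<close> depends only on the
  choices before \<open>j\<close>; appending a maximiser therefore keeps all earlier choices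
  maximal.\<close>

lemma greedy_sequence_exists:
  fixes f :: "(nat \<Rightarrow> 'e) \<Rightarrow> nat \<Rightarrow> 'e \<Rightarrow> 'v::linorder"
  assumes "finite E" and "k \<le> card E"
    and local: "\<And>c c' j a. (\<And>i. i < j \<Longrightarrow> c i = c' i) \<Longrightarrow> f c j a = f c' j a"
  shows "\<exists>c. inj_on c {..<k} \<and> c ` {..<k} \<subseteq> E \<and>
    (\<forall>j<k. \<forall>a\<in>E - c ` {..<j}. f c j a \<le> f c j (c j))"
  using \<open>k \<le> card E\<close>
proof (induction k)
  case (Suc k)
  then obtain c where c: "inj_on c {..<k}" "c ` {..<k} \<subseteq> E"
    and greedy: "\<And>j a. j < k \<Longrightarrow> a \<in> E - c ` {..<j} \<Longrightarrow> f c j a \<le> f c j (c j)"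
    by auto
  let ?R = "E - c ` {..<k}"
  have "card (c ` {..<k}) < card E"
    using Suc.prems by (simp add: card_image[OF c(1)])
  then have "?R \<noteq> {}"
    using c(2) by (metis Diff_eq_empty_iff order.irrefl subset_antisym)
  then have "Max (f c k ` ?R) \<in> f c k ` ?R"
    using \<open>finite E\<close> by (intro Max_in) auto
  then obtain y where y: "y \<in> ?R" "f c k y = Max (f c k ` ?R)"
    by auto
  define c' where "c' = c(k := y)"
  have eq: "c' i = c i" if "i < k" for i
    using that by (simp add: c'_def)
  have im: "c' ` {..<j} = c ` {..<j}" if "j \<le> k" for j
    using that by (intro image_cong) (auto simp: c'_def)
  have feq: "f c' j a = f c j a" if "j \<le> k" for j a
    using that by (intro local) (auto simp: c'_def)
  have "f c' j a \<le> f c' j (c' j)" if "j < Suc k" "a \<in> E - c' ` {..<j}" for j a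
  proof (cases "j = k")
    case True
    have "f c k a \<le> f c k y"
      using that True \<open>finite E\<close> y(2) by (auto simp: im)
    then show ?thesis
      using True feq[of k] by (simp add: c'_def)
  next
    case False
    then show ?thesis
      using that greedy[of j a] by (simp add: feq im eq)
  qed
  moreover have "inj_on c' {..<Suc k}"
    using c(1) y(1) im[of k] inj_on_cong[of "{..<k}" c' c] eq
    by (auto simp: lessThan_Suc c'_def)
  moreover have "c' ` {..<Suc k} \<subseteq> E"
    using c(2) y(1) im[of k] by (auto simp: lessThan_Suc c'_def)
  ultimately show ?case
    by (intro exI[of _ c']) auto
qed simp

section \<open>Construction of the vector family and comparison of the greedoids\<close>

theorem theorem6p9:
  fixes E :: "('v::linordered_ab_group_add \<Rightarrow>\<^sub>0 'k::field) set"
    and w :: "('v \<Rightarrow>\<^sub>0 'k) \<Rightarrow> 'v"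
    and d :: "('v \<Rightarrow>\<^sub>0 'k) \<Rightarrow> ('v \<Rightarrow>\<^sub>0 'k) \<Rightarrow> 'v"
  assumes "finite E"
    and "\<And>a b. a \<in> E \<Longrightarrow> b \<in> E \<Longrightarrow> a \<noteq> b \<Longrightarrow> d a b = - ga_ord (a - b)"
  shows "ultra_triple E w d \<and>
    (\<exists>(m::nat) (v :: ('v \<Rightarrow>\<^sub>0 'k) \<Rightarrow> 'k vec).
       card E \<le> m \<and> (\<forall>e\<in>E. v e \<in> carrier_vec m) \<and>
       bhargava_greedoid E w d = gaussian_elimination_greedoid E v)"
proof
  show triple: "ultra_triple E w d"
    using assms(2) by (rule ultra_triple_ga_ord)
  have sym: "d a b = d b a" if "a \<in> E" "b \<in> E" "a \<noteq> b" for a b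
    using triple that by (auto simp: ultra_triple_def)
  \<comment> \<open>The sums of distances put the earlier element first, whereas the products below
    contain later minus earlier.\<close>
  have d_eq: "d a b = - ga_ord (b - a)" if "a \<in> E" "b \<in> E" "a \<noteq> b" for a b
    using sym[OF that] assms(2)[of b a] that by simp
  define n where "n = card E"
  define f where "f = (\<lambda>c (j::nat) a. w a + (\<Sum>i<j. d (c i) a))"
  have "\<exists>c. inj_on c {..<n} \<and> c ` {..<n} \<subseteq> E \<and>
      (\<forall>j<n. \<forall>a\<in>E - c ` {..<j}. f c j a \<le> f c j (c j))"
    using assms(1) by (intro greedy_sequence_exists) (auto simp: n_def f_def)
  then obtain c where inj_c: "inj_on c {..<n}" and cE: "\<And>i. i < n \<Longrightarrow> c i \<in> E"
    and greedy: "\<And>j a. j < n \<Longrightarrow> a \<in> E - c ` {..<j} \<Longrightarrow> f c j a \<le> f c j (c j)"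
    by blast
  define \<rho> where "\<rho> = (\<lambda>j. f c j (c j))"
  define X where "X = (\<lambda>j a. Poly_Mapping.single (\<rho> j) (1::'k) * Poly_Mapping.single (- w a) 1
      * (\<Prod>i<j. a - c i))"
  \<comment> \<open>Coordinate \<open>j\<close> does not depend on how many coordinates are kept, so
    one family serves subsets of all sizes.\<close>
  define v where "v = (\<lambda>a. vec n (\<lambda>j. Poly_Mapping.lookup (X j a) 0))"

  have X_lead: "has_lead 0 (Poly_Mapping.lookup (X j a) 0) (X j a)" if "j < n" "a \<in> E" for j a
  proof (cases "a \<in> c ` {..<j}")
    case True
    \<comment> \<open>Greediness says nothing about a used \<open>a\<close>, but then some factor
      \<open>a - c i\<close> is zero.\<close>
    then have "X j a = 0"
      by (auto simp: X_def intro!: prod_zero)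
    then show ?thesis
      by (simp add: has_lead_zero)
  next
    case False
    let ?\<gamma> = "\<rho> j + - w a + (\<Sum>i<j. ga_ord (a - c i))"
    have "has_lead (\<Sum>i<j. ga_ord (a - c i))
        (\<Prod>i<j. Poly_Mapping.lookup (a - c i) (ga_ord (a - c i))) (\<Prod>i<j. a - c i)"
      using False by (intro has_lead_prod has_lead_ga_ord) auto
    then have "\<exists>e. has_lead ?\<gamma> e (X j a)"
      unfolding X_def by (blast intro: has_lead_mult has_lead_single)
    moreover have "(\<Sum>i<j. d (c i) a) = - (\<Sum>i<j. ga_ord (a - c i))"
      unfolding sum_negf[symmetric] using False that by (intro sum.cong refl d_eq cE) auto
    then have "0 \<le> ?\<gamma>"
      using greedy[of j a] that False by (simp add: \<rho>_def f_def algebra_simps)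
    ultimately show ?thesis
      using has_lead_lower by blast
  qed

  \<comment> \<open>Each \<open>\<rho> j\<close> is the gain at stage \<open>j\<close>, so the gains
    add up along every initial segment of the greedy sequence.\<close>
  have per_c: "perimeter w d (c ` {..<k}) = (\<Sum>j<k. \<rho> j)" if "k \<le> n" for k
    unfolding \<rho>_def f_def
    using that inj_c by (intro perimeter_enum sym cE) (auto simp: inj_on_def)

  have key: "perimeter w d F \<le> perimeter w d (c ` {..<card F})"
      "lin_indpt_family (card F) F (\<lambda>e. vec_first (v e) (card F)) \<longleftrightarrow>
       perimeter w d F = perimeter w d (c ` {..<card F})" if "F \<subseteq> E" for F
  proof -
    define k where "k = card F"
    have "k \<le> n"
      unfolding k_def n_def using assms(1) that by (rule card_mono)
    obtain x where x: "bij_betw x {..<k} F"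
      using ex_bij_betw_nat_finite[of F] finite_subset[OF \<open>F \<subseteq> E\<close> assms(1)]
      by (auto simp: k_def lessThan_atLeast0)
    then have inj_x: "inj_on x {..<k}" and F: "F = x ` {..<k}"
      by (auto simp: bij_betw_def)
    then have xE: "x r \<in> E" if "r < k" for r
      using that \<open>F \<subseteq> E\<close> by auto
    have x_ne: "x r \<noteq> x i" if "i < r" "r < k" for i r
      using inj_onD[OF inj_x, of r i] that by auto
    let ?D = "det (mat k k (\<lambda>(j, r). X j (x r)))"
    let ?R = "mat k k (\<lambda>(j, r). Poly_Mapping.lookup (X j (x r)) 0)"
    let ?ord = "\<lambda>i r. ga_ord (x r - x i)"
    \<comment> \<open>\<open>?\<gamma>\<close> and \<open>?e\<close> are the exact order and leading
      coefficient of \<open>?D\<close>, read off its factorisation into monomials and a Vandermonde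
      product.\<close>
    let ?\<gamma> = "(\<Sum>j<k. \<rho> j) + (\<Sum>r<k. - w (x r)) + (\<Sum>r<k. \<Sum>i<r. ?ord i r)"
    let ?e = "(\<Prod>j<k. 1 :: 'k) * (\<Prod>r<k. 1) * (\<Prod>r<k. \<Prod>i<r. Poly_Mapping.lookup (x r - x i) (?ord i r))"
    \<comment> \<open>The entries alone give only order at least 0: the coefficient
      \<open>det ?R\<close> may vanish.\<close>
    have D0: "has_lead 0 (det ?R) ?D"
      using \<open>k \<le> n\<close> by (intro has_lead_det[where n = k]) (auto intro!: X_lead xE)
    have "?D = (\<Prod>j<k. Poly_Mapping.single (\<rho> j) 1) * (\<Prod>r<k. Poly_Mapping.single (- w (x r)) 1)
        * (\<Prod>r<k. \<Prod>i<r. x r - x i)"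
      unfolding X_def det_mat_scale det_newton ..
    then have D: "has_lead ?\<gamma> ?e ?D"
      using x_ne
      by (simp only:) (intro has_lead_mult has_lead_prod has_lead_single has_lead_ga_ord, auto)
    have e: "?e \<noteq> 0"
      using x_ne by (auto intro!: lookup_ga_ord)
    have per_F: "perimeter w d F = (\<Sum>r<k. w (x r) + (\<Sum>i<r. d (x i) (x r)))"
      unfolding F using inj_x by (intro perimeter_enum sym xE) (auto simp: inj_on_def)
    have "(\<Sum>i<r. d (x i) (x r)) = - (\<Sum>i<r. ?ord i r)" if "r < k" for r
      unfolding sum_negf[symmetric] using that x_ne[of _ r]
      by (intro sum.cong refl d_eq xE) force+
    then have "perimeter w d F = (\<Sum>r<k. w (x r) + - (\<Sum>i<r. ?ord i r))"
      unfolding per_F by (intro sum.cong) auto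
    then have \<gamma>: "?\<gamma> = perimeter w d (c ` {..<k}) - perimeter w d F"
      using per_c[OF \<open>k \<le> n\<close>] by (simp add: sum_subtractf sum_negf)
    \<comment> \<open>The exact order \<open>?\<gamma>\<close> is at least the bound 0 from
      \<open>D0\<close>, and it is the difference of the two perimeters.\<close>
    show "perimeter w d F \<le> perimeter w d (c ` {..<card F})"
      using has_lead_compare(1)[OF D0 D e] unfolding \<gamma> by (simp add: k_def)
    \<comment> \<open>\<open>k \<le> n\<close> ensures that all \<open>k\<close> coordinates kept by
      the truncation exist in \<open>v\<close>.\<close>
    have "mat k k (\<lambda>(j, r). vec_first (v (x r)) k $ j) = ?R"
      using \<open>k \<le> n\<close> by (intro eq_matI) (auto simp: vec_first_def v_def)
    then have "lin_indpt_family k F (\<lambda>e. vec_first (v e) k) \<longleftrightarrow> det ?R \<noteq> 0"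
      using lin_indpt_family_det[OF x, of "\<lambda>e. vec_first (v e) k"] by simp
    then show "lin_indpt_family (card F) F (\<lambda>e. vec_first (v e) (card F)) \<longleftrightarrow>
       perimeter w d F = perimeter w d (c ` {..<card F})"
      using has_lead_compare(2)[OF D0 D e] unfolding \<gamma> by (auto simp: k_def)
  qed

  \<comment> \<open>The greedy initial segment of size \<open>card F\<close> is itself a competitor
    and bounds all others, so maximality means having the same perimeter.\<close>
  have "F \<in> bhargava_greedoid E w d \<longleftrightarrow> F \<in> gaussian_elimination_greedoid E v" for F
  proof (cases "F \<subseteq> E")
    case True
    then have le: "card F \<le> n"
      unfolding n_def using assms(1) by (intro card_mono)
    then have "card (c ` {..<card F}) = card F"
      using inj_on_subset[OF inj_c, of "{..<card F}"] by (simp add: card_image)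
    moreover have "c ` {..<card F} \<subseteq> E"
      using cE le by auto
    ultimately show ?thesis
      using True key unfolding bhargava_greedoid_def gaussian_elimination_greedoid_def
      by (auto intro!: antisym) metis
  qed (auto simp: bhargava_greedoid_def gaussian_elimination_greedoid_def)
  then have "bhargava_greedoid E w d = gaussian_elimination_greedoid E v"
    by auto
  moreover have "card E \<le> n"
    by (simp add: n_def)
  moreover have "\<forall>e\<in>E. v e \<in> carrier_vec n"
    by (simp add: v_def)
  ultimately show "\<exists>m (v :: ('v \<Rightarrow>\<^sub>0 'k) \<Rightarrow> 'k vec). card E \<le> m \<and> (\<forall>e\<in>E. v e \<in> carrier_vec m) \<and>
      bhargava_greedoid E w d = gaussian_elimination_greedoid E v"
    by blast
qed

end
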